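(* There exists an infinite family $\{G_i\}_{i\in\mathbb N}$ of (pairwise non-isomorphic) finite simple undirected graphs such that for every $i$, $\kappa_Q(G_i)\le 0.811\, n_i$, where $n_i$ is the order (number of vertices) of $G_i$.
   Context: Graphs are finite, nonempty, simple and undirected. For a graph $G=(V,E)$ and $C\subseteq V$, let $Odd(C)=\{v\in V : |N(v)\cap C|\equiv 1 \pmod 2\}$, where $N(v)$ is the open neighborhood of $v$. A set $B\subseteq V$ is a weak odd dominated (WOD) set if there exists $C\subseteq V\setminus B$ with $B\subseteq Odd(C)$. Let $\kappa(G)$ be the maximum size of a WOD set of $G$ and $\kappa'(G)$ the minimum size of a subset of $V$ that is not a WOD set. With $n=|V|$, $\kappa_Q(G)=\max(\kappa(G),\,n-\kappa'(G))$. *)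

theory Defs
  imports Complex_Main "Graph_Theory.Pair_Digraph" "Graph_Theory.Digraph_Isomorphism"
begin

text \<open>
  A finite simple undirected graph is a \<open>pair_graph\<close>: a finite vertex set with a symmetric,
  irreflexive arc relation, so that the edge \<open>{u, v}\<close> is the pair of arcs \<open>(u, v)\<close>, \<open>(v, u)\<close>.
\<close>

definition nbhd :: "'a pair_pre_digraph \<Rightarrow> 'a \<Rightarrow> 'a set" where
  "nbhd G v = {u \<in> pverts G. (v, u) \<in> parcs G}"

definition Odd :: "'a pair_pre_digraph \<Rightarrow> 'a set \<Rightarrow> 'a set" where
  "Odd G C = {v \<in> pverts G. odd (card (nbhd G v \<inter> C))}"

definition wod :: "'a pair_pre_digraph \<Rightarrow> 'a set \<Rightarrow> bool" where
  "wod G B \<longleftrightarrow> B \<subseteq> pverts G \<and> (\<exists>C. C \<subseteq> pverts G - B \<and> B \<subseteq> Odd G C)"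

definition kappa :: "'a pair_pre_digraph \<Rightarrow> nat" where
  "kappa G = Max {card B | B. wod G B}"

definition kappa' :: "'a pair_pre_digraph \<Rightarrow> nat" where
  "kappa' G = Min {card B | B. B \<subseteq> pverts G \<and> \<not> wod G B}"

definition kappa_Q :: "'a pair_pre_digraph \<Rightarrow> nat" where
  "kappa_Q G = max (kappa G) (card (pverts G) - kappa' G)"

text \<open>
  On finite nonempty graphs the maximum and the minimum range over finite nonempty sets, and
  the subtraction in \<open>kappa_Q\<close> does not truncate.
\<close>

lemma wod_empty: "wod G {}"
  by (auto simp: wod_def)

lemma not_wod_verts: "pverts G \<noteq> {} \<Longrightarrow> \<not> wod G (pverts G)"
  by (auto simp: wod_def Odd_def)

lemma kappa_range:
  assumes "finite (pverts G)"
  shows "finite {card B | B. wod G B}" "{card B | B. wod G B} \<noteq> {}"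
proof -
  have "{card B | B. wod G B} \<subseteq> card ` Pow (pverts G)"
    by (auto simp: wod_def)
  then show "finite {card B | B. wod G B}"
    using assms by (meson finite_Pow_iff finite_imageI finite_subset)
  show "{card B | B. wod G B} \<noteq> {}"
    using wod_empty by blast
qed

lemma kappa'_range:
  assumes "finite (pverts G)" "pverts G \<noteq> {}"
  shows "finite {card B | B. B \<subseteq> pverts G \<and> \<not> wod G B}"
    and "card (pverts G) \<in> {card B | B. B \<subseteq> pverts G \<and> \<not> wod G B}"
proof -
  have "{card B | B. B \<subseteq> pverts G \<and> \<not> wod G B} \<subseteq> card ` Pow (pverts G)"
    by auto
  then show "finite {card B | B. B \<subseteq> pverts G \<and> \<not> wod G B}"
    using assms by (meson finite_Pow_iff finite_imageI finite_subset)
  show "card (pverts G) \<in> {card B | B. B \<subseteq> pverts G \<and> \<not> wod G B}"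
    using not_wod_verts[OF assms(2)] by blast
qed

lemma kappa'_le:
  assumes "finite (pverts G)" "pverts G \<noteq> {}"
  shows "kappa' G \<le> card (pverts G)"
  unfolding kappa'_def using kappa'_range[OF assms] by (rule Min_le)

end

theory Submission
  imports Defs
begin

text \<open>
  Random graphs work. Write \<open>r\<close> for \<open>0.189 * n\<close>. If \<open>B\<close> is WOD via \<open>C\<close>, then \<open>B \<subseteq> Odd C - C\<close>;
  if \<open>B\<close> is not WOD, then linear algebra over the field with two elements gives a nonempty
  \<open>D \<subseteq> B\<close> with \<open>Odd D \<subseteq> B\<close>. So \<open>\<kappa>\<^sub>Q \<le> n - r\<close> as soon as no nonempty \<open>D\<close> has \<open>Odd D - D\<close> of the
  form \<open>M - D\<close> or \<open>V - M\<close> with \<open>D \<subseteq> M\<close> and \<open>card M \<le> r\<close>. In a uniformly random graph the set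
  \<open>Odd D - D\<close> is uniform in \<open>V - D\<close>, so the expected number of such pairs \<open>(M, D)\<close> is at most
  \<open>2 * 2 ^ (- n) * (\<Sum>m\<le>r. (n choose m) * 3 ^ m)\<close>. This is less than 1 because
  \<open>H(0.189) + 0.189 * log 2 3 < 1\<close> for the binary entropy \<open>H\<close>.
\<close>

section \<open>Parity, subset sums and linear algebra modulo 2\<close>

lemma even_card_sym_diff_iff:
  assumes "finite A" "finite B"
  shows "even (card (sym_diff A B)) \<longleftrightarrow> (even (card A) \<longleftrightarrow> even (card B))"
proof -
  have "card (sym_diff A B) = card (A - B) + card (B - A)"
    using assms by (intro card_Un_disjoint) auto
  moreover have "card A = card (A - B) + card (A \<inter> B)"
    using assms by (metis Diff_Diff_Int Diff_subset add.commute card_Diff_subset_Int card_mono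
        finite_Diff finite_Int inf_le1 le_add_diff_inverse2 Int_commute)
  moreover have "card B = card (B - A) + card (A \<inter> B)"
    using assms by (metis Diff_Diff_Int Diff_subset add.commute card_Diff_subset_Int card_mono
        finite_Diff finite_Int inf_le1 le_add_diff_inverse2 Int_commute)
  ultimately show ?thesis
    by presburger
qed

text \<open>Expand the product of \<open>a + b\<close> over \<open>A\<close>: \<open>X\<close>
  records the factors that contribute \<open>a\<close>.\<close>

lemma sum_Pow_power_card:
  fixes a b :: "'b::comm_semiring_1"
  assumes "finite A"
  shows "(\<Sum>X\<in>Pow A. a ^ card X * b ^ (card A - card X)) = (a + b) ^ card A"
proof -
  have "(a + b) ^ card A = (\<Prod>x\<in>A. a + b)"
    by simp
  also have "\<dots> = (\<Sum>X\<in>Pow A. (\<Prod>x\<in>X. a) * (\<Prod>x\<in>A - X. b))"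
    using assms by (rule prod_add)
  also have "\<dots> = (\<Sum>X\<in>Pow A. a ^ card X * b ^ (card A - card X))"
    using assms by (intro sum.cong) (auto simp: card_Diff_subset finite_subset)
  finally show ?thesis ..
qed

text \<open>
  The Fredholm alternative over the field with two elements, with vectors encoded as sets: either
  \<open>F\<close> is a combination of the columns \<open>K a\<close>, or some \<open>D\<close> is orthogonal to all columns but not to
  \<open>F\<close>.
\<close>

lemma parity_alternative:
  assumes "finite A" "finite B"
  shows "(\<exists>C\<subseteq>A. \<forall>b\<in>B. b \<in> F \<longleftrightarrow> odd (card {a \<in> C. b \<in> K a})) \<or>
         (\<exists>D\<subseteq>B. odd (card (D \<inter> F)) \<and> (\<forall>a\<in>A. even (card (D \<inter> K a))))"
  using assms(1)
proof (induction A arbitrary: F rule: finite_induct)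
  case empty
  show ?case
  proof (cases "B \<inter> F = {}")
    case False
    then obtain b where "b \<in> B" "b \<in> F" by blast
    then show ?thesis
      by (intro disjI2 exI[of _ "{b}"]) auto
  qed auto
next
  case (insert a A)
  show ?case
  proof (rule disjCI)
    assume no: "\<not> (\<exists>D\<subseteq>B. odd (card (D \<inter> F)) \<and> (\<forall>x\<in>insert a A. even (card (D \<inter> K x))))"
    show "\<exists>C\<subseteq>insert a A. \<forall>b\<in>B. b \<in> F \<longleftrightarrow> odd (card {x \<in> C. b \<in> K x})"
    proof (rule ccontr)
      assume unsolvable: "\<not> ?thesis"
      \<comment> \<open>A solution may or may not use \<open>a\<close>, so neither \<open>F\<close>
        nor \<open>sym_diff F (K a)\<close> is solvable over \<open>A\<close>.\<close>
      have "\<not> (\<exists>C\<subseteq>A. \<forall>b\<in>B. b \<in> F \<longleftrightarrow> odd (card {x \<in> C. b \<in> K x}))"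
        using unsolvable by blast
      then obtain D1 where D1: "D1 \<subseteq> B" "odd (card (D1 \<inter> F))" "\<forall>x\<in>A. even (card (D1 \<inter> K x))"
        using insert.IH[of F] by blast
      have "\<not> (\<exists>C\<subseteq>A. \<forall>b\<in>B. b \<in> sym_diff F (K a) \<longleftrightarrow> odd (card {x \<in> C. b \<in> K x}))"
      proof
        assume "\<exists>C\<subseteq>A. \<forall>b\<in>B. b \<in> sym_diff F (K a) \<longleftrightarrow> odd (card {x \<in> C. b \<in> K x})"
        then obtain C where C: "C \<subseteq> A"
          "\<forall>b\<in>B. b \<in> sym_diff F (K a) \<longleftrightarrow> odd (card {x \<in> C. b \<in> K x})"
          by blast
        have fin: "finite C" and a: "a \<notin> C"
          using C(1) insert.hyps finite_subset by blast+
        have "b \<in> F \<longleftrightarrow> odd (card {x \<in> insert a C. b \<in> K x})" if "b \<in> B" for b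
        proof -
          have "{x \<in> insert a C. b \<in> K x} =
              (if b \<in> K a then insert a {x \<in> C. b \<in> K x} else {x \<in> C. b \<in> K x})"
            by auto
          then show ?thesis
            using C(2) that fin a by auto
        qed
        then show False
          using unsolvable C(1) by (metis insert_mono)
      qed
      then obtain D2 where D2: "D2 \<subseteq> B" "odd (card (D2 \<inter> sym_diff F (K a)))"
        "\<forall>x\<in>A. even (card (D2 \<inter> K x))"
        using insert.IH[of "sym_diff F (K a)"] by blast
      have fin: "finite D1" "finite D2"
        using D1(1) D2(1) assms(2) finite_subset by blast+
      have "D2 \<inter> sym_diff F (K a) = sym_diff (D2 \<inter> F) (D2 \<inter> K a)"
        by auto
      then have split2: "even (card (D2 \<inter> F)) \<longleftrightarrow> odd (card (D2 \<inter> K a))"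
        using D2(2) fin even_card_sym_diff_iff[of "D2 \<inter> F" "D2 \<inter> K a"] by auto
      have odd1: "odd (card (D1 \<inter> K a))"
        using no D1 by blast
      have odd2: "odd (card (D2 \<inter> K a))"
        using no D2 split2 by blast
      have even2: "even (card (D2 \<inter> F))"
        using odd2 split2 by blast
      \<comment> \<open>\<open>D1\<close> and \<open>D2\<close> are both odd on \<open>K a\<close>
        but differ in parity on \<open>F\<close>, so their sum modulo 2 is the excluded
        certificate.\<close>
      have dist: "even (card (sym_diff D1 D2 \<inter> X)) \<longleftrightarrow>
          (even (card (D1 \<inter> X)) \<longleftrightarrow> even (card (D2 \<inter> X)))" for X
      proof -
        have "sym_diff D1 D2 \<inter> X = sym_diff (D1 \<inter> X) (D2 \<inter> X)" by auto
        then show ?thesis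
          using fin by (simp add: even_card_sym_diff_iff)
      qed
      have "sym_diff D1 D2 \<subseteq> B"
        using D1(1) D2(1) by blast
      moreover have "odd (card (sym_diff D1 D2 \<inter> F))"
        using D1(2) even2 by (simp only: dist) blast
      moreover have "\<forall>x\<in>insert a A. even (card (sym_diff D1 D2 \<inter> K x))"
        using D1(3) D2(3) odd1 odd2 by (simp only: dist) blast
      ultimately show False
        using no by blast
    qed
  qed
qed

text \<open>In the alternative, take the neighbourhoods of vertices outside \<open>B\<close> as
  columns and \<open>B\<close> as target: a \<open>D\<close> orthogonal to all columns has no odd
  vertex outside \<open>B\<close>.\<close>

lemma not_wodE:
  assumes fin: "finite (pverts G)" and sym: "sym (parcs G)"
    and B: "B \<subseteq> pverts G" "\<not> wod G B"
  obtains D where "D \<subseteq> B" "D \<noteq> {}" "Odd G D \<subseteq> B"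
proof -
  let ?A = "pverts G - B"
  have finB: "finite B"
    using fin B(1) finite_subset by blast
  have "\<not> (\<exists>C\<subseteq>?A. \<forall>b\<in>B. b \<in> B \<longleftrightarrow> odd (card {a \<in> C. b \<in> nbhd G a}))"
  proof
    assume "\<exists>C\<subseteq>?A. \<forall>b\<in>B. b \<in> B \<longleftrightarrow> odd (card {a \<in> C. b \<in> nbhd G a})"
    then obtain C where C: "C \<subseteq> ?A" "\<forall>b\<in>B. odd (card {a \<in> C. b \<in> nbhd G a})"
      by blast
    have "{a \<in> C. b \<in> nbhd G a} = nbhd G b \<inter> C" if "b \<in> B" for b
      using that C(1) B(1) sym by (auto simp: nbhd_def dest: symD)
    then have "B \<subseteq> Odd G C"
      using C(2) B(1) by (auto simp: Odd_def)
    then show False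
      using C(1) B by (auto simp: wod_def)
  qed
  then obtain D where D: "D \<subseteq> B" "odd (card (D \<inter> B))" "\<forall>a\<in>?A. even (card (D \<inter> nbhd G a))"
    using parity_alternative[of ?A B B "nbhd G"] fin finB by auto
  have "D \<noteq> {}"
    using D(2) by auto
  moreover have "Odd G D \<subseteq> B"
    using D(3) by (auto simp: Odd_def Int_commute)
  ultimately show thesis
    using that D(1) by blast
qed

section \<open>Random graphs\<close>

text \<open>
  Only two-element members of \<open>E\<close> matter. The random graph is \<open>edge_graph V E\<close> with \<open>E\<close> uniform in
  \<open>Pow (Pow V)\<close>, the members of other sizes being harmless idle bits.
\<close>

definition edge_graph :: "'a set \<Rightarrow> 'a set set \<Rightarrow> 'a pair_pre_digraph" where
  "edge_graph V E = \<lparr>pverts = V, parcs = {(a, b). a \<in> V \<and> b \<in> V \<and> a \<noteq> b \<and> {a, b} \<in> E}\<rparr>"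

lemma pverts_edge_graph [simp]: "pverts (edge_graph V E) = V"
  by (simp add: edge_graph_def)

lemma nbhd_edge_graph: "v \<in> V \<Longrightarrow> nbhd (edge_graph V E) v = {u \<in> V. u \<noteq> v \<and> {v, u} \<in> E}"
  by (auto simp: nbhd_def edge_graph_def)

lemma sym_edge_graph: "sym (parcs (edge_graph V E))"
  by (auto simp: edge_graph_def sym_def insert_commute)

lemma pair_graph_edge_graph:
  assumes "finite V"
  shows "pair_graph (edge_graph V E)"
proof -
  have "parcs (edge_graph V E) \<subseteq> V \<times> V"
    by (auto simp: edge_graph_def)
  then have "finite (parcs (edge_graph V E))"
    using assms by (meson finite_SigmaI finite_subset)
  then show ?thesis
    using assms sym_edge_graph[of V E]
    by unfold_locales (auto simp: edge_graph_def symmetric_def)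
qed

text \<open>For \<open>v\<close> outside \<open>D\<close>, the only pair joining it to
  \<open>D\<close> that can flip is \<open>{u, v}\<close>, and it flips exactly when
  \<open>v \<in> W\<close>.\<close>

lemma Odd_edge_graph_flip:
  assumes "finite V" "D \<subseteq> V" "u \<in> D" "W \<subseteq> V - D"
  shows "Odd (edge_graph V (sym_diff E ((\<lambda>w. {u, w}) ` W))) D - D =
         sym_diff (Odd (edge_graph V E) D - D) W"
proof -
  let ?G = "edge_graph V E" and ?H = "edge_graph V (sym_diff E ((\<lambda>w. {u, w}) ` W))"
  have "odd (card (nbhd ?H v \<inter> D)) \<longleftrightarrow> odd (card (nbhd ?G v \<inter> D)) \<noteq> (v \<in> W)"
    if v: "v \<in> V - D" for v
  proof -
    have "nbhd ?H v \<inter> D = sym_diff (nbhd ?G v \<inter> D) (if v \<in> W then {u} else {})"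
      using v assms(2-4) by (auto simp: nbhd_edge_graph doubleton_eq_iff)
    moreover have "finite (nbhd ?G v \<inter> D)"
      using assms(1,2) finite_subset by blast
    ultimately show ?thesis
      by (simp add: even_card_sym_diff_iff)
  qed
  then show ?thesis
    using assms(4) by (auto simp: Odd_def)
qed

text \<open>
  Flipping the pairs between a fixed \<open>u \<in> D\<close> and \<open>W\<close> adds \<open>W\<close> to the odd neighbourhood outside \<open>D\<close>,
  so every value \<open>S\<close> of that neighbourhood is equally likely.
\<close>

lemma card_Odd_fibre_le:
  assumes V: "finite V" and D: "D \<subseteq> V" "D \<noteq> {}"
  shows "2 ^ card V * card {E \<in> Pow (Pow V). Odd (edge_graph V E) D - D = S} \<le>
         2 ^ card D * card (Pow (Pow V))"
proof -
  obtain u where u: "u \<in> D" using D(2) by blast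
  let ?N = "{E \<in> Pow (Pow V). Odd (edge_graph V E) D - D = S}"
  let ?star = "\<lambda>W. (\<lambda>w. {u, w}) ` W"
  let ?flip = "\<lambda>(W, E). sym_diff E (?star W)"
  have "inj_on ?flip (Pow (V - D) \<times> ?N)"
  proof (rule inj_onI, clarify)
    fix W E W' E'
    assume W: "W \<subseteq> V - D" "W' \<subseteq> V - D"
      and E: "Odd (edge_graph V E') D - D = Odd (edge_graph V E) D - D"
      and eq: "sym_diff E (?star W) = sym_diff E' (?star W')"
    \<comment> \<open>Both flips give the same graph and start from the same fibre, so
      \<open>W\<close> can be read off; undoing the flip recovers \<open>E\<close>.\<close>
    have "sym_diff (Odd (edge_graph V E) D - D) W = sym_diff (Odd (edge_graph V E) D - D) W'"
      using Odd_edge_graph_flip[OF V D(1) u W(1), of E] Odd_edge_graph_flip[OF V D(1) u W(2), of E']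
      by (simp only: eq E)
    then have "W = W'" by blast
    moreover have "E = E'" using eq unfolding \<open>W = W'\<close> by blast
    ultimately show "W = W' \<and> E = E'" ..
  qed
  moreover have "?flip ` (Pow (V - D) \<times> ?N) \<subseteq> Pow (Pow V)"
    using u D(1) by fastforce
  ultimately have "card (Pow (V - D) \<times> ?N) \<le> card (Pow (Pow V))"
    using V by (intro card_inj_on_le[of ?flip]) auto
  then have "2 ^ (card V - card D) * card ?N \<le> card (Pow (Pow V))"
    using V D(1) by (simp add: card_cartesian_product card_Pow card_Diff_subset finite_subset)
  then have "2 ^ card D * (2 ^ (card V - card D) * card ?N) \<le> 2 ^ card D * card (Pow (Pow V))"
    by (rule mult_left_mono) simp
  moreover have "(2::nat) ^ card D * 2 ^ (card V - card D) = 2 ^ card V"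
    using V D(1) by (simp add: card_mono flip: power_add)
  ultimately show ?thesis
    by (simp add: mult.assoc[symmetric])
qed

section \<open>Sparse pairs and the union bound\<close>

text \<open>The first alternative captures a small non-WOD set with certificate \<open>D\<close>,
  the second a large WOD set with witness \<open>D\<close>.\<close>

definition sparse_pair :: "'a pair_pre_digraph \<Rightarrow> nat \<Rightarrow> 'a set \<Rightarrow> 'a set \<Rightarrow> bool" where
  "sparse_pair G r M D \<longleftrightarrow> M \<subseteq> pverts G \<and> card M \<le> r \<and> D \<subseteq> M \<and> D \<noteq> {} \<and>
     (Odd G D - D = M - D \<or> Odd G D - D = pverts G - M)"

text \<open>
  The weight 13 comes from the generating function bound
  \<open>\<Sum>m\<le>r. (n choose m) * 3 ^ m \<le> 13 ^ r * (1 + 3 / 13) ^ n\<close>, whose base \<open>16 / 13\<close> is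
  both close to optimal for \<open>r = 0.189 * n\<close> and a power of two divided by 13.
\<close>

lemma ex_no_sparse_pair:
  fixes V :: "'a set"
  assumes V: "finite V" and r: "r \<le> card V" and num: "2 * 8 ^ card V < (13::nat) ^ (card V - r)"
  obtains E where "\<And>M D. \<not> sparse_pair (edge_graph V E) r M D"
proof -
  define n where "n = card V"
  define T where "T = card (Pow (Pow V))"
  define fibre where "fibre D S = {E \<in> Pow (Pow V). Odd (edge_graph V E) D - D = S}" for D S
  define I where "I = (SIGMA M:{M \<in> Pow V. card M \<le> r}. Pow M - {{}})"
  define Bad where "Bad = (\<Union>(M, D)\<in>I. fibre D (M - D) \<union> fibre D (V - M))"
  have finI: "finite I"
    using V unfolding I_def by (intro finite_SigmaI) (auto intro: finite_subset)
  have T: "T > 0"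
    using V unfolding T_def by (simp add: card_Pow)
  have card_fibre: "2 ^ n * card (fibre D S) \<le> 2 ^ card D * T" if "D \<subseteq> V" "D \<noteq> {}" for D S
    using card_Odd_fibre_le[OF V that] unfolding n_def T_def fibre_def .
  have "2 ^ n * card Bad \<le> 2 ^ n * (\<Sum>(M, D)\<in>I. card (fibre D (M - D)) + card (fibre D (V - M)))"
    unfolding Bad_def
    by (intro mult_left_mono order_trans[OF card_UN_le[OF finI]] sum_mono)
       (auto intro: card_Un_le)
  also have "\<dots> = (\<Sum>(M, D)\<in>I. 2 ^ n * card (fibre D (M - D)) + 2 ^ n * card (fibre D (V - M)))"
    by (simp add: sum_distrib_left algebra_simps case_prod_unfold)
  also have "\<dots> \<le> (\<Sum>(M, D)\<in>I. 2 ^ card D * T + 2 ^ card D * T)"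
    unfolding I_def by (intro sum_mono) (auto intro!: add_mono card_fibre)
  also have "\<dots> = 2 * T * (\<Sum>(M, D)\<in>I. 2 ^ card D)"
    unfolding sum_distrib_left by (intro sum.cong) auto
  also have "(\<Sum>(M, D)\<in>I. (2::nat) ^ card D) = (\<Sum>M | M \<in> Pow V \<and> card M \<le> r. \<Sum>D\<in>Pow M - {{}}. 2 ^ card D)"
    unfolding I_def using V by (subst sum.Sigma) (auto intro: finite_subset)
  also have "\<dots> \<le> (\<Sum>M | M \<in> Pow V \<and> card M \<le> r. 3 ^ card M)"
  proof (rule sum_mono)
    fix M assume "M \<in> {M. M \<in> Pow V \<and> card M \<le> r}"
    then have "finite M"
      using V finite_subset by blast
    then have "(\<Sum>D\<in>Pow M - {{}}. 2 ^ card D) \<le> (\<Sum>D\<in>Pow M. (2::nat) ^ card D * 1 ^ (card M - card D))"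
      by (simp only: power_one mult_1_right, intro sum_mono2) auto
    also have "\<dots> = (2 + 1) ^ card M"
      using \<open>finite M\<close> by (rule sum_Pow_power_card)
    finally show "(\<Sum>D\<in>Pow M - {{}}. 2 ^ card D) \<le> (3::nat) ^ card M"
      by simp
  qed
  finally have Bad_le: "2 ^ n * card Bad \<le> 2 * T * (\<Sum>M | M \<in> Pow V \<and> card M \<le> r. 3 ^ card M)"
    by simp
  \<comment> \<open>For \<open>card M \<le> r\<close> the factor is at most
    \<open>13 ^ (n - card M)\<close>, so the truncated sum extends to a full binomial sum.\<close>
  have "(13::nat) ^ (n - r) * (\<Sum>M | M \<in> Pow V \<and> card M \<le> r. 3 ^ card M) \<le>
      (\<Sum>M | M \<in> Pow V \<and> card M \<le> r. 3 ^ card M * 13 ^ (n - card M))"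
    unfolding sum_distrib_left
    by (intro sum_mono) (auto simp: mult.commute intro!: mult_mono power_increasing)
  also have "\<dots> \<le> (\<Sum>M\<in>Pow V. 3 ^ card M * 13 ^ (n - card M))"
    using V by (intro sum_mono2) auto
  also have "\<dots> = (3 + 13) ^ n"
    unfolding n_def using V by (rule sum_Pow_power_card)
  finally have sum_le: "13 ^ (n - r) * (\<Sum>M | M \<in> Pow V \<and> card M \<le> r. 3 ^ card M) \<le> (16::nat) ^ n"
    by simp
  have "2 ^ n * (13 ^ (n - r) * card Bad) \<le>
      2 * T * (13 ^ (n - r) * (\<Sum>M | M \<in> Pow V \<and> card M \<le> r. 3 ^ card M))"
    using mult_left_mono[OF Bad_le, of "13 ^ (n - r)"] by (simp add: algebra_simps)
  also have "\<dots> \<le> 2 * T * 16 ^ n"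
    using sum_le by (rule mult_left_mono) simp
  also have "\<dots> = 2 ^ n * (T * (2 * 8 ^ n))"
    by (simp flip: power_mult_distrib)
  finally have "13 ^ (n - r) * card Bad \<le> T * (2 * 8 ^ n)"
    by simp
  also have "\<dots> < T * 13 ^ (n - r)"
    using num T unfolding n_def by simp
  finally have "card Bad < card (Pow (Pow V))"
    unfolding T_def by simp
  moreover have "Bad \<subseteq> Pow (Pow V)"
    unfolding Bad_def fibre_def by auto
  ultimately obtain E where E: "E \<in> Pow (Pow V)" "E \<notin> Bad"
    by (metis less_irrefl subsetI subset_antisym)
  have "\<not> sparse_pair (edge_graph V E) r M D" for M D
    using E unfolding Bad_def fibre_def I_def sparse_pair_def by auto
  then show thesis
    using that by blast
qed

section \<open>From sparse pairs to \<open>kappa_Q\<close>\<close>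

lemma kappa_Q_le:
  assumes fin: "finite (pverts G)" and ne: "pverts G \<noteq> {}" and sym: "sym (parcs G)"
    and no: "\<And>M D. \<not> sparse_pair G r M D"
  shows "kappa_Q G \<le> card (pverts G) - r"
proof -
  have "card B \<le> card (pverts G) - r" if B: "wod G B" for B
  proof (cases "B = {}")
    case False
    obtain C where C: "C \<subseteq> pverts G - B" "B \<subseteq> Odd G C"
      using B by (auto simp: wod_def)
    \<comment> \<open>\<open>?M\<close> contains \<open>C\<close> and misses \<open>B\<close>, so
      its size bounds that of \<open>B\<close>; \<open>C\<close> is nonempty because
      \<open>B\<close> is.\<close>
    let ?M = "pverts G - (Odd G C - C)"
    have "C \<noteq> {}"
      using C(2) False by (auto simp: Odd_def)
    moreover have "pverts G - ?M = Odd G C - C"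
      by (auto simp: Odd_def)
    ultimately have "r < card ?M"
      using no[of ?M C] C(1) by (auto simp: sparse_pair_def)
    moreover have "?M \<subseteq> pverts G - B"
      using C by auto
    then have "card ?M \<le> card (pverts G) - card B"
      using fin B
      by (metis card_Diff_subset card_mono finite_Diff finite_subset wod_def)
    ultimately show ?thesis by linarith
  qed simp
  then have "kappa G \<le> card (pverts G) - r"
    unfolding kappa_def using kappa_range[OF fin] by auto
  moreover have "r \<le> card B" if B: "B \<subseteq> pverts G" "\<not> wod G B" for B
  proof -
    obtain D where D: "D \<subseteq> B" "D \<noteq> {}" "Odd G D \<subseteq> B"
      using not_wodE[OF fin sym B] .
    \<comment> \<open>With \<open>M = D \<union> Odd G D\<close> the first alternative holds
      trivially, and \<open>M\<close> lies inside \<open>B\<close>.\<close>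
    have "\<not> card (D \<union> Odd G D) \<le> r"
      using no[of "D \<union> Odd G D" D] D B(1) by (auto simp: sparse_pair_def)
    moreover have "card (D \<union> Odd G D) \<le> card B"
      using D B(1) fin by (intro card_mono) (auto intro: finite_subset)
    ultimately show ?thesis by linarith
  qed
  then have "r \<le> kappa' G"
    unfolding kappa'_def using kappa'_range[OF fin ne] by (subst Min_ge_iff) auto
  ultimately show ?thesis
    unfolding kappa_Q_def by auto
qed

section \<open>Numerical estimate and the family\<close>

lemma digraph_iso_card_verts:
  assumes "digraph_iso G H"
  shows "card (verts G) = card (verts H)"
  using assms
  by (auto simp: digraph_iso_def verts_app_iso pre_digraph.digraph_isomorphism_def card_image)

text \<open>
  Since \<open>13 ^ 10\<close> is slightly larger than \<open>2 ^ 37\<close>, Bernoulli's inequality for the 81st power of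
  the quotient gains the missing factor \<open>16 / 13\<close>.
\<close>

lemma two_mult_8_power_1000_less: "2 * 8 ^ 1000 < (13::nat) ^ 811"
proof -
  \<comment> \<open>The exponents are \<open>3001 = 4 + 37 * 81\<close> and
    \<open>811 = 1 + 10 * 81\<close>.\<close>
  have regroup: "x * (x ^ 3) ^ 1000 = x ^ 4 * (x ^ 37) ^ 81" "x ^ 811 = x * (x ^ 10) ^ 81" for x :: real
    by (simp_all flip: power_mult power_Suc power_add)
  \<comment> \<open>\<open>1 / 328\<close> is the largest unit fraction below
    \<open>13 ^ 10 / 2 ^ 37 - 1\<close>.\<close>
  have "16 < 13 * (1 + real 81 * (1 / 328))" by simp
  also have "\<dots> \<le> 13 * (1 + 1 / 328) ^ 81"
    by (intro mult_left_mono Bernoulli_inequality) simp_all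
  also have "\<dots> \<le> 13 * (13 ^ 10 / 2 ^ 37) ^ 81"
    by (intro mult_left_mono power_mono) simp_all
  also have "\<dots> = 13 * (13 ^ 10) ^ 81 / (2 ^ 37) ^ 81"
    by (simp only: power_divide times_divide_eq_right)
  finally have "16 * (2 ^ 37) ^ 81 < (13::real) * (13 ^ 10) ^ 81"
    by (simp only: pos_less_divide_eq zero_less_power zero_less_numeral)
  moreover have "(8::real) = 2 ^ 3" "(16::real) = 2 ^ 4"
    by simp_all
  ultimately have "2 * 8 ^ 1000 < (13::real) ^ 811"
    by (simp only: regroup)
  then have "real (2 * 8 ^ 1000) < real (13 ^ 811)"
    by (simp only: of_nat_mult of_nat_power of_nat_numeral)
  then show ?thesis
    by (simp only: of_nat_less_iff)
qed

lemma two_mult_8_power_less_13_power: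
  assumes "k > 0"
  shows "2 * 8 ^ (1000 * k) < (13::nat) ^ (811 * k)"
proof -
  have "2 * 8 ^ (1000 * k) \<le> (2 ^ k * (8 ^ 1000) ^ k :: nat)"
    unfolding power_mult using assms by (intro mult_right_mono[OF _ le0] self_le_power) simp_all
  also have "\<dots> = (2 * 8 ^ 1000) ^ k"
    by (rule power_mult_distrib[symmetric])
  also have "\<dots> < (13 ^ 811) ^ k"
    using two_mult_8_power_1000_less le0 assms by (rule power_strict_mono)
  finally show ?thesis
    by (simp only: power_mult)
qed

theorem theorem8:
  shows "\<exists>G :: nat \<Rightarrow> nat pair_pre_digraph.
    (\<forall>i. pair_graph (G i) \<and> pverts (G i) \<noteq> {}) \<and>
    (\<forall>i j. i \<noteq> j \<longrightarrow> \<not> digraph_iso (with_proj (G i)) (with_proj (G j))) \<and>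
    (\<forall>i. real (kappa_Q (G i)) \<le> 0.811 * real (card (pverts (G i))))"
proof -
  \<comment> \<open>Orders divisible by 1000 make \<open>0.189 * n\<close> an integer;
    \<open>Suc\<close> keeps them positive, and their distinctness rules out isomorphisms.\<close>
  define V :: "nat \<Rightarrow> nat set" where "V i = {..<1000 * Suc i}" for i
  have V: "finite (V i)" "V i \<noteq> {}" "card (V i) = 1000 * Suc i" for i
    by (auto simp: V_def lessThan_empty_iff)
  have "\<exists>E. kappa_Q (edge_graph (V i) E) \<le> 811 * Suc i" for i
  proof -
    have diff: "card (V i) - 189 * Suc i = 811 * Suc i"
      by (simp add: V(3))
    have "2 * 8 ^ card (V i) < (13::nat) ^ (card (V i) - 189 * Suc i)"
      unfolding diff by (subst V(3), rule two_mult_8_power_less_13_power) simp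
    moreover have "189 * Suc i \<le> card (V i)"
      by (simp add: V(3))
    ultimately obtain E where E: "\<And>M D. \<not> sparse_pair (edge_graph (V i) E) (189 * Suc i) M D"
      using ex_no_sparse_pair[OF V(1)] by blast
    have "kappa_Q (edge_graph (V i) E) \<le> card (V i) - 189 * Suc i"
      using kappa_Q_le[OF _ _ sym_edge_graph E] V(1,2) by simp
    then show ?thesis
      unfolding diff ..
  qed
  then obtain E where E: "\<And>i. kappa_Q (edge_graph (V i) (E i)) \<le> 811 * Suc i"
    by metis
  show ?thesis
  proof (intro exI[of _ "\<lambda>i. edge_graph (V i) (E i)"] conjI allI impI)
    fix i show "pair_graph (edge_graph (V i) (E i))"
      using V(1) by (rule pair_graph_edge_graph)
  next
    fix i show "pverts (edge_graph (V i) (E i)) \<noteq> {}"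
      using V(2) by simp
  next
    fix i j :: nat assume "i \<noteq> j"
    then show "\<not> digraph_iso (with_proj (edge_graph (V i) (E i))) (with_proj (edge_graph (V j) (E j)))"
      using V(3) by (auto dest: digraph_iso_card_verts)
  next
    fix i
    have "real (kappa_Q (edge_graph (V i) (E i))) \<le> real (811 * Suc i)"
      using E[of i] by (simp only: of_nat_le_iff)
    also have "\<dots> = 0.811 * real (card (pverts (edge_graph (V i) (E i))))"
      by (simp add: V(3))
    finally show "real (kappa_Q (edge_graph (V i) (E i))) \<le>
        0.811 * real (card (pverts (edge_graph (V i) (E i))))" .
  qed
qed

end
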